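(* In Version C, the $\mathcal{P}$-positions with $3$, $4$, or $5$ piles are precisely the following, where the piles are listed in nondecreasing order. \begin{itemize} \item For $3$ piles: the positions in $\langle e,e,e\rangle$ and $\langle o,o,o\rangle$. \item For $4$ piles: the positions in $\langle e,e,e,e\rangle$ and $\langle e,o,o,o\rangle$. \item For $5$ piles: the positions in $\langle e,e,e,e,e\rangle$, $\langle e,e,o,o,o\rangle$, $\langle o,o,e,e,o\rangle$, and $\langle o,o,o,o,e\rangle$. \end{itemize}
   Context: Version C is a two-player impartial game. A position consists of finitely many piles of tokens, with sizes nonnegative integers. The players alternate turns; on a turn, a player either removes a single token from any one nonempty pile, or selects two different nonempty piles and removes one token from each of those two. The last player to move wins. A position is a $\mathcal{P}$-position if the player who is not about to move has a winning strategy, equivalently if none of its options (positions reachable in one move) is a $\mathcal{P}$-position; otherwise it is an $\mathcal{N}$-position. Notation: for $x_1,\dots,x_n\in\{e,o\}$, $\langle x_1,x_2,\ldots,x_n\rangle$ denotes the set of all positions $a_1,a_2,\ldots,a_n$ with $a_1\leq a_2\leq\cdots\leq a_n$ such that, for every $1\leq i\leq n$, $x_i$ is the parity of $a_i$ ($e$ for even, $o$ for odd). *)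

theory Defs
  imports Main "HOL-Library.Multiset"
begin

text \<open>A position is the multiset of its pile sizes. Empty piles are kept as entries 0, so
  \<^term>\<open>size p\<close> is the number of piles and is not changed by a move. In the rule \<open>two\<close>,
  the two piles are different occurrences in the multiset; their sizes may coincide.\<close>

type_synonym position = "nat multiset"

inductive move :: "position \<Rightarrow> position \<Rightarrow> bool" where
  one: "move (add_mset (Suc a) p) (add_mset a p)"
| two: "move (add_mset (Suc a) (add_mset (Suc b) p)) (add_mset a (add_mset b p))"

lemma move_sum_mset_less: "move p q \<Longrightarrow> sum_mset q < sum_mset p"
  by (induction rule: move.induct) auto

text \<open>Under normal play a position is a P-position iff none of its options is one. Every move
  removes a token, so this determines the predicate uniquely.\<close>

function P_position :: "position \<Rightarrow> bool" where
  "P_position p \<longleftrightarrow> (\<forall>q. move p q \<longrightarrow> \<not> P_position q)"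
  by pat_completeness auto
termination
  by (relation "measure sum_mset") (auto intro: move_sum_mset_less)

declare P_position.simps [simp del]

datatype parity = Even | Odd

definition parity_of :: "nat \<Rightarrow> parity" where
  "parity_of a = (if even a then Even else Odd)"

text \<open>\<open>parity_class [x\<^sub>1, \<dots>, x\<^sub>n]\<close> is the set written
  \<open>\<langle>x\<^sub>1, \<dots>, x\<^sub>n\<rangle>\<close> in the literature: the parities are those of the pile sizes
  listed in nondecreasing order.\<close>

definition parity_class :: "parity list \<Rightarrow> position set" where
  "parity_class xs = {mset as | as. sorted as \<and> map parity_of as = xs}"

end

theory Submission
  imports Defs
begin

text \<open>A move changes the nondecreasing list of pile sizes by lowering one or two of its entries by
  one, since lowering one of several equal piles may be taken to lower the leftmost ones. Hence a
  move flips one or two letters of the parity word. A set of words is therefore the set of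
  P-positions as soon as any two of its words differ in at least three letters and every word
  outside it can be brought into it by one or two flips that all sorted lists with this word
  admit. For at most five piles this is a finite check.\<close>

definition lowers :: "nat \<Rightarrow> nat \<Rightarrow> bool" where
  "lowers a b \<longleftrightarrow> a = b \<or> a = Suc b"

text \<open>Ties are settled here: \<open>x\<close> and \<open>y\<close> may be inserted at
  different places, but only among entries so close in size that the shifted pairs still satisfy
  \<open>lowers\<close>.\<close>

lemma list_all2_lowers_insort:
  assumes "list_all2 lowers xs ys" "sorted xs" "sorted ys" "lowers x y"
  shows "list_all2 lowers (insort x xs) (insort y ys)"
  using assms
proof (induction arbitrary: x y rule: list_all2_induct)
  case Nil
  then show ?case by simp
next
  case (Cons a as b bs)
  have a: "insort a as = a # as" and b: "insort b bs = b # bs"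
    using Cons.prems by (auto simp: insort_is_Cons)
  consider "x \<le> a \<and> y \<le> b \<or> a < x \<and> b < y" | "x \<le> a" "b < y" | "a < x" "y \<le> b"
    by linarith
  then show ?case
  proof cases
    case 1
    then show ?thesis using Cons by auto
  next
    \<comment> \<open>All bounds are tight: \<open>x = a = y = Suc b\<close>, so \<open>x\<close>
      may be paired with \<open>b\<close>, and \<open>a\<close> with \<open>y\<close>.\<close>
    case 2
    then have "lowers x b" "lowers a y"
      using Cons.hyps Cons.prems by (auto simp: lowers_def)
    then show ?thesis
      using 2 Cons.IH[of a y] Cons.prems a by auto
  next
    \<comment> \<open>Mirrored situation: \<open>a = b = y\<close> and
      \<open>x = Suc a\<close>.\<close>
    case 3
    then have "lowers a y" "lowers x b"
      using Cons.hyps Cons.prems by (auto simp: lowers_def)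
    then show ?thesis
      using 3 Cons.IH[of x b] Cons.prems b by auto
  qed
qed

lemma list_all2_lowers_sorted_list_add_mset:
  assumes "list_all2 lowers (sorted_list_of_multiset p) (sorted_list_of_multiset q)" "lowers a b"
  shows "list_all2 lowers (sorted_list_of_multiset (add_mset a p))
    (sorted_list_of_multiset (add_mset b q))"
  using assms by (simp add: list_all2_lowers_insort)

lemma move_imp_lowers:
  assumes "move p q"
  shows "list_all2 lowers (sorted_list_of_multiset p) (sorted_list_of_multiset q)"
    and "sum_mset p = sum_mset q + 1 \<or> sum_mset p = sum_mset q + 2"
proof -
  have refl: "list_all2 lowers xs xs" for xs
    by (simp add: list_all2_refl lowers_def)
  have "lowers (Suc a) a" for a
    by (simp add: lowers_def)
  with assms show "list_all2 lowers (sorted_list_of_multiset p) (sorted_list_of_multiset q)"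
    by cases (auto intro!: list_all2_lowers_sorted_list_add_mset refl
        simp del: sorted_list_of_multiset_insert)
  from assms show "sum_mset p = sum_mset q + 1 \<or> sum_mset p = sum_mset q + 2"
    by cases auto
qed

lemma lowers_sum_list_le: "list_all2 lowers xs ys \<Longrightarrow> sum_list ys \<le> sum_list xs"
  by (induction rule: list_all2_induct) (auto simp: lowers_def)

lemma lowers_sum_list_eq: "list_all2 lowers xs ys \<Longrightarrow> sum_list xs = sum_list ys \<Longrightarrow> xs = ys"
proof (induction rule: list_all2_induct)
  case (Cons x xs y ys)
  then show ?case using lowers_sum_list_le[OF Cons.hyps(2)] by (auto simp: lowers_def)
qed simp

text \<open>The difference of the sums counts the lowered entries, so exactly one is lowered. It
  serves as the second pile of a \<open>two\<close> move in \<open>lowers_imp_move\<close>.\<close>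

lemma lowers_sum_list_Suc:
  assumes "list_all2 lowers xs ys" "sum_list xs = Suc (sum_list ys)"
  obtains a r where "mset xs = add_mset (Suc a) r" "mset ys = add_mset a r"
proof -
  have "\<exists>a r. mset xs = add_mset (Suc a) r \<and> mset ys = add_mset a r"
    using assms
  proof (induction rule: list_all2_induct)
    case (Cons x xs y ys)
    show ?case
    proof (cases "x = y")
      case True
      then obtain a r where "mset xs = add_mset (Suc a) r" "mset ys = add_mset a r"
        using Cons by auto
      then show ?thesis
        using True by (intro exI[of _ a] exI[of _ "add_mset y r"]) simp
    next
      case False
      then show ?thesis
        using Cons lowers_sum_list_eq[of xs ys] by (auto simp: lowers_def)
    qed
  qed simp
  with that show ?thesis by blast
qed

lemma move_add_mset: "move p q \<Longrightarrow> move (add_mset a p) (add_mset a q)"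
  by (induction rule: move.induct)
    (metis add_mset_commute move.one, metis add_mset_commute move.two)

lemma lowers_imp_move:
  assumes "list_all2 lowers xs ys"
    and "sum_list xs = sum_list ys + 1 \<or> sum_list xs = sum_list ys + 2"
  shows "move (mset xs) (mset ys)"
  using assms
proof (induction rule: list_all2_induct)
  case (Cons x xs y ys)
  \<comment> \<open>The head is untouched, or it is the only lowered pile, or the tail contains
    exactly one more.\<close>
  consider "x = y" | "x = Suc y" "xs = ys" | "x = Suc y" "sum_list xs = Suc (sum_list ys)"
    using Cons.hyps Cons.prems lowers_sum_list_eq[of xs ys] by (auto simp: lowers_def)
  then show ?case
  proof cases
    case 1
    then show ?thesis using Cons by (simp add: move_add_mset)
  next
    case 2
    then show ?thesis by (simp add: move.one)
  next
    case 3
    from lowers_sum_list_Suc[OF Cons.hyps(2) 3(2)] obtain a r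
      where "mset xs = add_mset (Suc a) r" "mset ys = add_mset a r" .
    then show ?thesis using 3 by (simp add: move.two)
  qed
qed simp

fun hamming :: "'a list \<Rightarrow> 'a list \<Rightarrow> nat" where
  "hamming (x # xs) (y # ys) = (if x = y then 0 else 1) + hamming xs ys"
| "hamming _ _ = 0"

text \<open>An entry changes parity exactly when it loses a token, so differing letters count the
  removed tokens.\<close>

lemma hamming_parity:
  "list_all2 lowers xs ys \<Longrightarrow>
    sum_list xs = sum_list ys + hamming (map parity_of xs) (map parity_of ys)"
  by (induction rule: list_all2_induct) (auto simp: lowers_def parity_of_def)

text \<open>A letter is flippable if it differs from its left neighbour, so that the entry is strictly
  larger than the preceding one, or if that neighbour is flipped as well. The two extra arguments
  are the left neighbour and whether it is flipped.\<close>

fun flippable :: "parity \<Rightarrow> bool \<Rightarrow> parity list \<Rightarrow> parity list \<Rightarrow> bool" where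
  "flippable x f (y # v) (z # w) \<longleftrightarrow> (y = z \<or> x \<noteq> y \<or> f) \<and> flippable y (y \<noteq> z) v w"
| "flippable _ _ [] [] \<longleftrightarrow> True"
| "flippable _ _ _ _ \<longleftrightarrow> False"

text \<open>Lower exactly the entries whose letters differ. Here \<open>m\<close> is the left
  neighbour before lowering and \<open>f\<close> tells whether it is lowered.\<close>

lemma flippable_lowers:
  assumes "flippable (parity_of m) f (map parity_of as) w" "sorted (m # as)" "f \<Longrightarrow> 0 < m"
  obtains bs where "list_all2 lowers as bs" "map parity_of bs = w"
    "sorted ((if f then m - 1 else m) # bs)"
proof -
  have "\<exists>bs. list_all2 lowers as bs \<and> map parity_of bs = w \<and>
      sorted ((if f then m - 1 else m) # bs)"
    using assms
  proof (induction as arbitrary: m f w)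
    case Nil
    then show ?case by (cases w) auto
  next
    case (Cons a as)
    then obtain z v where w: "w = z # v" by (cases w) auto
    let ?g = "parity_of a \<noteq> z"
    let ?b = "if ?g then a - 1 else a"
    have flip: "?g \<Longrightarrow> parity_of m \<noteq> parity_of a \<or> f"
      and rec: "flippable (parity_of a) ?g (map parity_of as) v"
      using Cons.prems(1) w by auto
    have "m \<le> a" using Cons.prems(2) by simp
    \<comment> \<open>If \<open>a = m\<close>, the parities agree, so \<open>f\<close> holds and
      hence \<open>0 < m\<close>.\<close>
    have pos: "0 < a" if ?g
      using flip[OF that] \<open>m \<le> a\<close> Cons.prems(3) by (cases "m = a") auto
    \<comment> \<open>If \<open>m < a\<close>, there is room to lower \<open>a\<close>; if
      \<open>a = m\<close> is lowered, then \<open>f\<close> holds and \<open>m\<close> is lowered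
      too.\<close>
    have le: "(if f then m - 1 else m) \<le> ?b"
      using flip \<open>m \<le> a\<close> by (cases "m = a") auto
    have par: "parity_of ?b = z"
      using pos by (cases z) (auto simp: parity_of_def split: if_splits)
    obtain bs where "list_all2 lowers as bs" "map parity_of bs = v" "sorted (?b # bs)"
      using Cons.IH[OF rec] Cons.prems(2) pos by auto
    moreover have "lowers a ?b" using pos by (auto simp: lowers_def)
    ultimately show ?case
      using par le w by (intro exI[of _ "?b # bs"]) auto
  qed
  with that show ?thesis by blast
qed

abbreviation parity_word :: "position \<Rightarrow> parity list" where
  "parity_word p \<equiv> map parity_of (sorted_list_of_multiset p)"

lemma length_sorted_list_of_multiset: "length (sorted_list_of_multiset p) = size p"
  by (metis mset_sorted_list_of_multiset size_mset)

lemma sum_list_sorted_list_of_multiset: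
  "sum_list (sorted_list_of_multiset p) = sum_mset (p :: nat multiset)"
  by (metis mset_sorted_list_of_multiset sum_mset_sum_list)

lemma hamming_parity_word_move:
  assumes "move p q"
  shows "hamming (parity_word p) (parity_word q) \<in> {1, 2}"
  using hamming_parity[OF move_imp_lowers(1)[OF assms]] move_imp_lowers(2)[OF assms]
  by (auto simp: sum_list_sorted_list_of_multiset)

lemma flippable_move:
  assumes "flippable Even False (parity_word p) w" "hamming (parity_word p) w \<in> {1, 2}"
  obtains q where "move p q" "parity_word q = w"
proof -
  \<comment> \<open>A fictitious untouched pile \<open>0\<close> serves as left neighbour of the
    first entry, so a leading even entry, which may be empty, is never lowered.\<close>
  obtain bs where bs: "list_all2 lowers (sorted_list_of_multiset p) bs"
    "map parity_of bs = w" "sorted bs"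
    using flippable_lowers[of 0 False "sorted_list_of_multiset p" w] assms(1)
    by (auto simp: parity_of_def)
  have "move (mset (sorted_list_of_multiset p)) (mset bs)"
    using bs assms(2) hamming_parity[OF bs(1)] by (intro lowers_imp_move) auto
  then show ?thesis
    using that[of "mset bs"] bs by (simp add: sorted_sort_id)
qed

lemma move_size: "move p q \<Longrightarrow> size q = size p"
  by (induction rule: move.induct) auto

text \<open>Words are given as lists so that each clause can be evaluated. Distance 0 is allowed in
  the second clause because of \<open>v = w\<close>.\<close>

definition winning_code :: "nat \<Rightarrow> parity list list \<Rightarrow> bool" where
  "winning_code n C \<longleftrightarrow>
    (\<forall>v\<in>set C. length v = n) \<and>
    (\<forall>v\<in>set C. \<forall>w\<in>set C. hamming v w \<notin> {1, 2}) \<and>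
    (\<forall>v\<in>set (List.n_lists n [Even, Odd]). v \<in> set C \<or>
      (\<exists>w\<in>set C. flippable Even False v w \<and> hamming v w \<in> {1, 2}))"

text \<open>Induction on the number of tokens. The distance clause excludes moves inside the code;
  from a word outside it, \<open>flippable_move\<close> turns the flip into a move to a
  P-position.\<close>

lemma P_position_iff_parity_word:
  assumes "winning_code n C" "size p = n"
  shows "P_position p \<longleftrightarrow> parity_word p \<in> set C"
  using assms(2)
proof (induction p rule: measure_induct_rule[of sum_mset])
  case (less p)
  have IH: "P_position q \<longleftrightarrow> parity_word q \<in> set C" if "move p q" for q
    using less that by (simp add: move_sum_mset_less move_size)
  have "length (parity_word p) = n"
    using less.prems by (simp add: length_sorted_list_of_multiset)
  moreover have "set (parity_word p) \<subseteq> {Even, Odd}"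
    by (auto simp: parity_of_def)
  ultimately have word: "parity_word p \<in> set (List.n_lists n [Even, Odd])"
    by (simp add: set_n_lists)
  show ?case
  proof
    assume "P_position p"
    then have "parity_word q \<notin> set C" if "move p q" for q
      using IH that P_position.simps by blast
    then show "parity_word p \<in> set C"
      using assms(1) word unfolding winning_code_def by (metis flippable_move)
  next
    assume "parity_word p \<in> set C"
    then have "\<not> P_position q" if "move p q" for q
      using IH[OF that] hamming_parity_word_move[OF that] assms(1)
      unfolding winning_code_def by blast
    then show "P_position p"
      using P_position.simps by blast
  qed
qed

lemma parity_class_iff: "p \<in> parity_class w \<longleftrightarrow> parity_word p = w"
proof
  assume "p \<in> parity_class w"
  then show "parity_word p = w"
    by (auto simp: parity_class_def sorted_sort_id)
next
  assume "parity_word p = w"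
  then show "p \<in> parity_class w"
    unfolding parity_class_def
    by (intro CollectI exI[of _ "sorted_list_of_multiset p"]) simp
qed

lemma P_positions_eq_parity_classes:
  assumes "winning_code n C"
  shows "{p. size p = n \<and> P_position p} = (\<Union>w\<in>set C. parity_class w)"
proof -
  have "size p = n \<and> P_position p \<longleftrightarrow> parity_word p \<in> set C" for p
  proof
    assume "parity_word p \<in> set C"
    then have "length (parity_word p) = n"
      using assms unfolding winning_code_def by blast
    then have "size p = n"
      by (simp add: length_sorted_list_of_multiset)
    then show "size p = n \<and> P_position p"
      using P_position_iff_parity_word[OF assms] \<open>parity_word p \<in> set C\<close> by blast
  qed (use P_position_iff_parity_word[OF assms] in blast)
  then show ?thesis
    by (simp add: parity_class_iff set_eq_iff)
qed

theorem lemma3p1: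
  shows "{p. size p = 3 \<and> P_position p} =
      parity_class [Even, Even, Even] \<union> parity_class [Odd, Odd, Odd] \<and>
    {p. size p = 4 \<and> P_position p} =
      parity_class [Even, Even, Even, Even] \<union> parity_class [Even, Odd, Odd, Odd] \<and>
    {p. size p = 5 \<and> P_position p} =
      parity_class [Even, Even, Even, Even, Even] \<union> parity_class [Even, Even, Odd, Odd, Odd] \<union>
      parity_class [Odd, Odd, Even, Even, Odd] \<union> parity_class [Odd, Odd, Odd, Odd, Even]"
proof -
  \<comment> \<open>Evaluation runs through all 8, 16 and 32 parity words.\<close>
  have "winning_code 3 [[Even, Even, Even], [Odd, Odd, Odd]]"
    and "winning_code 4 [[Even, Even, Even, Even], [Even, Odd, Odd, Odd]]"
    and "winning_code 5 [[Even, Even, Even, Even, Even], [Even, Even, Odd, Odd, Odd],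
      [Odd, Odd, Even, Even, Odd], [Odd, Odd, Odd, Odd, Even]]"
    by code_simp+
  from this[THEN P_positions_eq_parity_classes] show ?thesis
    by (simp add: Un_assoc)
qed

end
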